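(* For each $\alpha>0$ let $V=V_\alpha\in C^2(\mathbb{R},\mathbb{R})$ be such that: ($V_1$) $V_\alpha\ge0$ on $\mathbb{R}$; ($V_2$) $V_\alpha(\alpha)=V_\alpha(-\alpha)=0$ and $V_\alpha(t)>0$ for all $t\in(-\alpha,\alpha)$; ($V_6$) $V_\alpha''(-\alpha)>0$ and $V_\alpha''(\alpha)>0$; ($V_7$) there are $d_1,d_2,d_3,d_4>0$ (possibly depending on $\alpha$) such that $-d_1t|t-\alpha|\le V_\alpha'(t)\le-d_2t|t-\alpha|$ for all $t\in[0,\alpha]$ and $-d_3t|t+\alpha|\le V_\alpha'(t)\le-d_4t|t+\alpha|$ for all $t\in[-\alpha,0]$; and such that, uniformly in the family, ($V_8$) there are $\tilde\alpha>0$ and $M(\tilde\alpha)>0$ such that $\sup_{|t|\in[0,\alpha]}|V_\alpha'(t)|\le M(\tilde\alpha)$ for all $\alpha\in(0,\tilde\alpha)$. Then there exists $\alpha_0>0$ such that for each $\alpha\in(0,\alpha_0)$ the problem $$-\left(\frac{u'}{\sqrt{1+(u')^2}}\right)'+V_\alpha'(u)=0\ \text{ in }\mathbb{R},\qquad u(0)=0,\qquad u(\pm\infty)=\pm\alpha,$$ has a unique twice differentiable solution $q$ in $C^{1,\gamma}_{\mathrm{loc}}(\mathbb{R})$ for some $\gamma\in(0,1)$, and there are constants $\theta_i,\beta_i>0$ ($i=1,\dots,4$) such that $$0<\alpha-q(t)\le\theta_1e^{-\theta_2t}\ \text{ and }\ 0<q'(t)\le\beta_1e^{-\beta_2t}\quad\text{for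 all }t\ge0,$$ $$0<\alpha+q(t)\le\theta_3e^{\theta_4t}\ \text{ and }\ 0<q'(t)\le\beta_3e^{\beta_4t}\quad\text{for all }t\le0.$$ Moreover, if $V_\alpha(t)=(t^2-\alpha^2)^2$, then $q$ satisfies $$\alpha\tanh\left(\alpha\sqrt2\,t\right)\le q(t)\le\alpha\tanh\left(\frac{\alpha\sqrt2\,t}{\kappa}\right)\quad\text{for }t\ge0,$$ where $\kappa$ is a positive constant that depends on $\|q'\|_{L^\infty(\mathbb{R})}$.
   Context: $u(\pm\infty)=\pm\alpha$ means $\lim_{t\to+\infty}u(t)=\alpha$ and $\lim_{t\to-\infty}u(t)=-\alpha$. *)

theory Defs
  imports "HOL-Analysis.Analysis" "HOL-Probability.Essential_Supremum"
begin

definition twice_differentiable :: "(real \<Rightarrow> real) \<Rightarrow> bool" where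
  "twice_differentiable u \<longleftrightarrow>
     (\<forall>t. u differentiable (at t)) \<and> (\<forall>t. deriv u differentiable (at t))"

definition C2 :: "(real \<Rightarrow> real) \<Rightarrow> bool" where
  "C2 u \<longleftrightarrow> twice_differentiable u \<and> continuous_on UNIV (deriv (deriv u))"

text \<open>Membership in \<open>C\<^sup>1\<^sup>,\<^sup>\<gamma>\<^sub>l\<^sub>o\<^sub>c(\<real>)\<close>. Continuity of \<open>deriv u\<close> need not be required
  separately: for \<open>\<gamma> > 0\<close> it follows from the Hoelder estimate.\<close>

definition C1_Holder_loc :: "real \<Rightarrow> (real \<Rightarrow> real) \<Rightarrow> bool" where
  "C1_Holder_loc \<gamma> u \<longleftrightarrow>
     (\<forall>t. u differentiable (at t)) \<and>
     (\<forall>K. compact K \<longrightarrow>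
        (\<exists>C. \<forall>s\<in>K. \<forall>t\<in>K. \<bar>deriv u s - deriv u t\<bar> \<le> C * \<bar>s - t\<bar> powr \<gamma>))"

text \<open>The real-valued \<open>L\<^sup>\<infinity>(\<real>)\<close> norm. It is the essential supremum when that is finite,
  and the junk value 0 otherwise; the latter cannot happen for a bounded measurable \<open>f\<close>.\<close>

definition Linf_norm :: "(real \<Rightarrow> real) \<Rightarrow> real" where
  "Linf_norm f = real_of_ereal (esssup lebesgue (\<lambda>t. ereal \<bar>f t\<bar>))"

text \<open>Twice differentiability of \<open>u\<close> makes \<open>u' / sqrt (1 + u'\<^sup>2)\<close> differentiable, so the
  outer \<open>deriv\<close> is a genuine derivative and the equation holds at every point.\<close>

definition heteroclinic_solution :: "(real \<Rightarrow> real) \<Rightarrow> real \<Rightarrow> (real \<Rightarrow> real) \<Rightarrow> bool" where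
  "heteroclinic_solution W \<alpha> u \<longleftrightarrow>
     twice_differentiable u \<and>
     (\<forall>t. - deriv (\<lambda>s. deriv u s / sqrt (1 + (deriv u s)\<^sup>2)) t + deriv W (u t) = 0) \<and>
     u 0 = 0 \<and>
     (u \<longlongrightarrow> \<alpha>) at_top \<and>
     (u \<longlongrightarrow> - \<alpha>) at_bot"

end

theory Submission imports Defs
begin

text \<open>Multiplying the equation by \<open>u'\<close> shows that \<open>1 - 1 / sqrt (1 + u'\<^sup>2) - V(u)\<close> is constant along a
  solution, and the limit \<open>u(+\<infinity>) = \<alpha>\<close> forces the constant to be 0 (\<open>first_integral\<close>). Wherever
  \<open>0 \<le> V < 1\<close> this can be solved for the velocity: \<open>\<bar>u'\<bar> = G(u)\<close> with
  \<open>G = sqrt (1 / (1 - V)\<^sup>2 - 1)\<close>, called \<open>speed\<close> below. The bound on \<open>V'\<close> that is uniform in the family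
  gives \<open>V \<le> 2 \<alpha> M\<close> on \<open>[-\<alpha>, \<alpha>]\<close>, so \<open>V \<le> 1 / 2\<close> there as soon as \<open>\<alpha> \<le> 1 / (4 M)\<close>; this is why \<open>\<alpha>\<close>
  has to be small.

  The growth condition on \<open>V'\<close> makes \<open>V\<close> comparable with the Allen--Cahn potential
  \<open>(\<alpha>\<^sup>2 - x\<^sup>2)\<^sup>2\<close> (\<open>quartic_bounds\<close>), hence \<open>G\<close> comparable with \<open>\<alpha>\<^sup>2 - x\<^sup>2\<close>. Everything then
  follows from comparing with \<open>y' = c (\<alpha>\<^sup>2 - y\<^sup>2)\<close>, whose solution through 0 is
  \<open>\<alpha> tanh (\<alpha> c t)\<close>. A solution of the problem cannot reach \<open>\<plusminus>\<alpha>\<close> in finite time (\<open>trapped\<close>), so its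
  velocity never vanishes; by continuity it has one sign, which must be positive. Thus the solutions of
  the problem are exactly the solutions of the autonomous first-order equation \<open>u' = G(u)\<close>,
  \<open>u(0) = 0\<close>, \<open>\<bar>u\<bar> < \<alpha>\<close> (the locale \<open>speed_orbit\<close>), which separation of variables solves uniquely
  (\<open>autonomous_heteroclinic\<close>). The two tanh barriers give the limits and the exponential decay. For
  \<open>V = (t\<^sup>2 - \<alpha>\<^sup>2)\<^sup>2\<close> one has \<open>sqrt (2 V) \<le> G \<le> sqrt (2 V) sqrt (1 + G\<^sup>2)\<close>, so the barriers
  have \<open>c = sqrt 2\<close> and \<open>c = sqrt 2 / \<kappa>\<close> with \<open>\<kappa> = 1 / sqrt (1 + L\<^sup>2)\<close>, \<open>L\<close> being the supremum
  norm of the velocity.\<close>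

section \<open>Comparison with the hyperbolic tangent\<close>

text \<open>The substitution \<open>y = artanh (q / \<alpha>)\<close> turns the Riccati equation
  \<open>q' = c (\<alpha>\<^sup>2 - q\<^sup>2)\<close> into \<open>y' = \<alpha> c\<close>.\<close>
lemma has_deriv_artanh_ratio:
  fixes q :: "real \<Rightarrow> real"
  assumes "\<alpha> > 0" and "\<bar>q t\<bar> < \<alpha>" and "(q has_real_derivative d) (at t)"
  shows "((\<lambda>s. artanh (q s / \<alpha>)) has_real_derivative \<alpha> * d / (\<alpha>\<^sup>2 - (q t)\<^sup>2)) (at t)"
proof -
  have lt: "\<bar>q t / \<alpha>\<bar> < 1"
    using assms by (simp add: abs_divide)
  have "(q t)\<^sup>2 < \<alpha>\<^sup>2"
    using assms by (simp add: abs_square_less_1 power2_strict_mono abs_less_iff)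
  then have eq: "1 / (1 - (q t / \<alpha>)\<^sup>2) * (d / \<alpha>) = \<alpha> * d / (\<alpha>\<^sup>2 - (q t)\<^sup>2)"
    using \<open>\<alpha> > 0\<close> by (simp add: field_simps power2_eq_square)
  show ?thesis
    unfolding eq[symmetric]
    by (rule DERIV_chain2[OF artanh_real_has_field_derivative[OF lt] DERIV_cdivide[OF assms(3)]])
qed

lemma tanh_artanh_real:
  assumes "\<bar>x\<bar> < (1::real)"
  shows "tanh (artanh x) = x"
proof -
  have "(1 + x) / (1 - x) > 0"
    using assms by auto
  then have "exp (- 2 * artanh x) = (1 - x) / (1 + x)"
    using assms by (simp add: artanh_def exp_minus)
  then have "tanh (artanh x) = (1 - (1 - x) / (1 + x)) / (1 + (1 - x) / (1 + x))"
    by (simp only: tanh_real_altdef)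
  moreover have "1 - (1 - x) / (1 + x) = 2 * x / (1 + x)" and "1 + (1 - x) / (1 + x) = 2 / (1 + x)"
    using assms by (auto simp: field_simps)
  ultimately show ?thesis
    using assms by simp
qed

text \<open>In the variable \<open>artanh (q / \<alpha>)\<close> the rate condition says that the slope is at least \<open>\<alpha> k\<close>.\<close>
lemma tanh_le_of_rate_ge:
  fixes q :: "real \<Rightarrow> real"
  assumes "\<alpha> > 0" and "q 0 = 0" and lt: "\<And>s. \<bar>q s\<bar> < \<alpha>"
    and q': "\<And>s. (q has_real_derivative q' s) (at s)"
    and rate: "\<And>s. k * (\<alpha>\<^sup>2 - (q s)\<^sup>2) \<le> q' s" and "t \<ge> 0"
  shows "\<alpha> * tanh (\<alpha> * k * t) \<le> q t"
proof -
  let ?h = "\<lambda>s. artanh (q s / \<alpha>) - \<alpha> * k * s"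
  have "?h 0 \<le> ?h t"
  proof (rule DERIV_nonneg_imp_nondecreasing[OF \<open>t \<ge> 0\<close>])
    fix s
    have pos: "\<alpha>\<^sup>2 - (q s)\<^sup>2 > 0"
      using lt[of s] \<open>\<alpha> > 0\<close> by (simp add: power2_strict_mono abs_less_iff)
    have "(?h has_real_derivative \<alpha> * q' s / (\<alpha>\<^sup>2 - (q s)\<^sup>2) - \<alpha> * k) (at s)"
      by (auto intro!: derivative_eq_intros has_deriv_artanh_ratio \<open>\<alpha> > 0\<close> lt q')
    moreover have "\<alpha> * k \<le> \<alpha> * q' s / (\<alpha>\<^sup>2 - (q s)\<^sup>2)"
      using mult_left_mono[OF rate[of s], of \<alpha>] \<open>\<alpha> > 0\<close> pos
      by (simp add: pos_le_divide_eq mult.assoc)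
    ultimately show "\<exists>y. (?h has_real_derivative y) (at s) \<and> y \<ge> 0"
      by (metis diff_ge_0_iff_ge)
  qed
  then have "\<alpha> * k * t \<le> artanh (q t / \<alpha>)"
    using \<open>q 0 = 0\<close> by simp
  then have "tanh (\<alpha> * k * t) \<le> tanh (artanh (q t / \<alpha>))"
    by simp
  also have "\<dots> = q t / \<alpha>"
    using lt[of t] \<open>\<alpha> > 0\<close> by (intro tanh_artanh_real) (simp add: abs_divide)
  finally show ?thesis
    using \<open>\<alpha> > 0\<close> by (simp add: field_simps)
qed

lemma le_tanh_of_rate_le:
  fixes q :: "real \<Rightarrow> real"
  assumes "\<alpha> > 0" and "q 0 = 0" and lt: "\<And>s. \<bar>q s\<bar> < \<alpha>"
    and q': "\<And>s. (q has_real_derivative q' s) (at s)"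
    and rate: "\<And>s. q' s \<le> k * (\<alpha>\<^sup>2 - (q s)\<^sup>2)" and "t \<ge> 0"
  shows "q t \<le> \<alpha> * tanh (\<alpha> * k * t)"
proof -
  have "\<alpha> * tanh (\<alpha> * (- k) * t) \<le> - q t"
    by (rule tanh_le_of_rate_ge[where q = "\<lambda>s. - q s" and q' = "\<lambda>s. - q' s"])
       (use assms in \<open>auto intro!: DERIV_minus\<close>)
  then show ?thesis
    by simp
qed

lemma one_minus_tanh_le: "1 - tanh (x::real) \<le> 2 * exp (- 2 * x)"
proof -
  have "1 - tanh x = 2 * exp (- 2 * x) / (1 + exp (- 2 * x))"
    by (simp add: tanh_real_altdef field_simps add_pos_pos add_nonneg_eq_0_iff)
  also have "\<dots> \<le> 2 * exp (- 2 * x) / 1"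
    by (intro divide_left_mono) (auto intro: add_pos_pos)
  finally show ?thesis
    by simp
qed

section \<open>Autonomous scalar equations between two equilibria\<close>

text \<open>Separation of variables: an antiderivative \<open>F\<close> of \<open>1 / G\<close> measures the time needed to reach a
  position, and the solution is its inverse. It is defined for all times because \<open>G\<close> vanishes at
  least linearly at the endpoints, so that reaching them would take infinitely long. Since
  \<open>F(u(t)) = t\<close> along every solution, there is only one.\<close>
lemma autonomous_heteroclinic:
  fixes G :: "real \<Rightarrow> real"
  assumes "\<alpha> > 0" and "K > 0"
    and cont: "\<And>x. \<bar>x\<bar> < \<alpha> \<Longrightarrow> isCont G x"
    and pos: "\<And>x. \<bar>x\<bar> < \<alpha> \<Longrightarrow> 0 < G x"
    and upper: "\<And>x. \<bar>x\<bar> < \<alpha> \<Longrightarrow> G x \<le> K * (\<alpha>\<^sup>2 - x\<^sup>2)"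
  obtains q where "q 0 = 0" and "\<And>t. \<bar>q t\<bar> < \<alpha>"
    and "\<And>t. (q has_real_derivative G (q t)) (at t)"
    and "\<And>u. \<lbrakk>u 0 = 0; \<And>t. \<bar>u t\<bar> < \<alpha>; \<And>t. (u has_real_derivative G (u t)) (at t)\<rbrakk> \<Longrightarrow> u = q"
proof -
  have "\<exists>F. \<forall>x. ereal (- \<alpha>) < ereal x \<longrightarrow> ereal x < ereal \<alpha>
          \<longrightarrow> (F has_vector_derivative 1 / G x) (at x)"
  proof (rule einterval_antiderivative)
    fix x assume "ereal (- \<alpha>) < ereal x" "ereal x < ereal \<alpha>"
    then have "\<bar>x\<bar> < \<alpha>" by auto
    then show "isCont (\<lambda>x. 1 / G x) x"
      using cont pos by (auto intro!: continuous_intros simp: less_imp_neq[symmetric])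
  qed (use \<open>\<alpha> > 0\<close> in auto)
  then obtain F0 where "\<forall>x. - \<alpha> < x \<longrightarrow> x < \<alpha> \<longrightarrow> (F0 has_vector_derivative 1 / G x) (at x)"
    by auto
  then have F0: "(F0 has_real_derivative 1 / G x) (at x)" if "\<bar>x\<bar> < \<alpha>" for x
    using that by (auto simp: has_real_derivative_iff_has_vector_derivative)
  define F where "F x = F0 x - F0 0" for x
  have F': "(F has_real_derivative 1 / G x) (at x)" if "\<bar>x\<bar> < \<alpha>" for x
    unfolding F_def using F0[OF that] by (auto intro!: derivative_eq_intros)
  have [simp]: "F 0 = 0" by (simp add: F_def)
  have mono: "F x < F y" if "\<bar>x\<bar> < \<alpha>" "\<bar>y\<bar> < \<alpha>" "x < y" for x y
  proof (rule DERIV_pos_imp_increasing[OF \<open>x < y\<close>])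
    fix z assume "x \<le> z" "z \<le> y"
    with that have "\<bar>z\<bar> < \<alpha>" by auto
    with F' pos show "\<exists>d. (F has_real_derivative d) (at z) \<and> 0 < d"
      by (meson zero_less_divide_1_iff)
  qed
  have inj: "x = y" if "\<bar>x\<bar> < \<alpha>" "\<bar>y\<bar> < \<alpha>" "F x = F y" for x y
    using mono[of x y] mono[of y x] that by force
  \<comment> \<open>Near the endpoints the antiderivative grows at least like the artanh, hence to infinity.\<close>
  have growth: "artanh (x / \<alpha>) - \<alpha> * K * F x \<ge> artanh (y / \<alpha>) - \<alpha> * K * F y"
    if "\<bar>x\<bar> < \<alpha>" "\<bar>y\<bar> < \<alpha>" "x \<le> y" for x y
  proof (rule DERIV_nonpos_imp_nonincreasing[OF \<open>x \<le> y\<close>])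
    fix z assume "x \<le> z" "z \<le> y"
    with that have z: "\<bar>z\<bar> < \<alpha>" by auto
    have "\<alpha>\<^sup>2 - z\<^sup>2 > 0"
      using z \<open>\<alpha> > 0\<close> by (simp add: power2_strict_mono abs_less_iff)
    then have "1 / (\<alpha>\<^sup>2 - z\<^sup>2) \<le> K / G z"
      using upper[OF z] pos[OF z] by (simp add: field_simps)
    then have "\<alpha> * 1 / (\<alpha>\<^sup>2 - z\<^sup>2) - \<alpha> * K * (1 / G z) \<le> 0"
      using mult_left_mono[of _ _ \<alpha>] \<open>\<alpha> > 0\<close> by fastforce
    moreover have "((\<lambda>x. artanh (x / \<alpha>) - \<alpha> * K * F x)
        has_real_derivative \<alpha> * 1 / (\<alpha>\<^sup>2 - z\<^sup>2) - \<alpha> * K * (1 / G z)) (at z)"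
      by (intro DERIV_diff DERIV_cmult F' z has_deriv_artanh_ratio[where q = "\<lambda>x. x"]
            \<open>\<alpha> > 0\<close> DERIV_ident)
    ultimately show "\<exists>d. ((\<lambda>x. artanh (x / \<alpha>) - \<alpha> * K * F x) has_real_derivative d) (at z) \<and> d \<le> 0"
      by blast
  qed
  have surj: "\<exists>x. \<bar>x\<bar> < \<alpha> \<and> F x = t" for t
  proof -
    \<comment> \<open>This is where the barrier moving with the maximal rate \<open>K\<close> is at time \<open>\<bar>t\<bar>\<close>; the orbit is
      no faster, so \<open>F b \<ge> \<bar>t\<bar>\<close> and \<open>F (-b) \<le> -\<bar>t\<bar>\<close>.\<close>
    define b where "b = \<alpha> * tanh (\<alpha> * K * \<bar>t\<bar>)"
    have art: "artanh (b / \<alpha>) = \<alpha> * K * \<bar>t\<bar>"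
      using \<open>\<alpha> > 0\<close> by (simp add: b_def artanh_tanh_real)
    have b: "0 \<le> b" "b < \<alpha>"
      using \<open>\<alpha> > 0\<close> \<open>K > 0\<close> tanh_real_lt_1 by (auto simp: b_def)
    have artm: "artanh (- b / \<alpha>) = - (\<alpha> * K * \<bar>t\<bar>)"
      using art b \<open>\<alpha> > 0\<close> artanh_minus_real[of "b / \<alpha>"] by simp
    have "\<alpha> * K * \<bar>t\<bar> \<le> \<alpha> * K * F b"
      using growth[of 0 b] b art \<open>\<alpha> > 0\<close> by simp
    then have upb: "\<bar>t\<bar> \<le> F b"
      using \<open>\<alpha> > 0\<close> \<open>K > 0\<close> by simp
    have "\<alpha> * K * F (- b) \<le> \<alpha> * K * (- \<bar>t\<bar>)"
      using growth[of "-b" 0] b artm \<open>\<alpha> > 0\<close> by simp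
    then have lob: "F (- b) \<le> - \<bar>t\<bar>"
      using \<open>\<alpha> > 0\<close> \<open>K > 0\<close> by (simp only: mult_le_cancel_left_pos mult_pos_pos)
    have "\<exists>x. - b \<le> x \<and> x \<le> b \<and> F x = t"
    proof (rule IVT)
      show "\<forall>x. - b \<le> x \<and> x \<le> b \<longrightarrow> isCont F x"
        using b by (intro allI impI DERIV_isCont[OF F']) auto
    qed (use upb lob b in auto)
    then obtain x where "- b \<le> x" "x \<le> b" "F x = t"
      by blast
    with b show ?thesis
      by (intro exI[of _ x]) auto
  qed
  define q where "q t = (SOME x. \<bar>x\<bar> < \<alpha> \<and> F x = t)" for t
  have q: "\<bar>q t\<bar> < \<alpha>" "F (q t) = t" for t
    using someI_ex[OF surj[of t]] by (auto simp: q_def)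
  have qF: "q (F x) = x" if "\<bar>x\<bar> < \<alpha>" for x
    using inj[OF q(1) that] q(2) by simp
  have q_cont: "isCont q t" for t
  proof -
    have "- \<alpha> < q t" "q t < \<alpha>"
      using q(1)[of t] by auto
    then obtain a b where "- \<alpha> < a" "a < q t" "q t < b" "b < \<alpha>"
      by (meson dense)
    have "isCont q (F (q t))"
    proof (rule isCont_inverse_function2[where f = F and x = "q t" and a = a and b = b])
      fix z assume "a \<le> z" "z \<le> b"
      then have z: "\<bar>z\<bar> < \<alpha>"
        using \<open>- \<alpha> < a\<close> \<open>b < \<alpha>\<close> by auto
      show "q (F z) = z"
        by (rule qF[OF z])
      show "isCont F z"
        by (rule DERIV_isCont[OF F'[OF z]])
    qed fact+
    then show ?thesis by (simp add: q)
  qed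
  have q': "(q has_real_derivative G (q t)) (at t)" for t
  proof -
    have "(q has_real_derivative inverse (1 / G (q t))) (at t)"
      using pos[OF q(1)[of t]]
      by (intro DERIV_inverse_function[where f = F and a = "t - 1" and b = "t + 1"] F' q q_cont) auto
    then show ?thesis by simp
  qed
  show thesis
  proof (rule that[of q])
    show "q 0 = 0"
      using qF[of 0] \<open>\<alpha> > 0\<close> by simp
    fix u assume u: "u 0 = 0" "\<And>t. \<bar>u t\<bar> < \<alpha>" "\<And>t. (u has_real_derivative G (u t)) (at t)"
    have "((\<lambda>t. F (u t) - t) has_real_derivative 0) (at t)" for t
    proof -
      have "((\<lambda>t. F (u t) - t) has_real_derivative 1 / G (u t) * G (u t) - 1) (at t)"
        by (intro DERIV_diff DERIV_ident DERIV_chain2[OF F' u(3)] u(2))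
      then show ?thesis
        using pos[OF u(2)[of t]] by simp
    qed
    then have "F (u t) - t = F (u 0) - 0" for t
      using DERIV_isconst_all[of "\<lambda>t. F (u t) - t"] by blast
    then have "F (u t) = t" for t
      using u(1) by simp
    then show "u = q"
      using inj[OF u(2) q(1)] q(2) by (intro ext) simp
  qed (use q q' in auto)
qed

section \<open>Conservation of energy\<close>

lemma has_deriv_sqrt_one_plus_square:
  assumes "(p has_real_derivative d) (at t)"
  shows "((\<lambda>s. sqrt (1 + (p s)\<^sup>2)) has_real_derivative p t * d / sqrt (1 + (p t)\<^sup>2)) (at t)"
proof -
  have "((\<lambda>s. 1 + (p s)\<^sup>2) has_real_derivative 2 * p t * d) (at t)"
    using assms by (auto intro!: derivative_eq_intros)
  then have "((\<lambda>s. sqrt (1 + (p s)\<^sup>2)) has_real_derivative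
      inverse (sqrt (1 + (p t)\<^sup>2)) / 2 * (2 * p t * d)) (at t)"
    by (rule DERIV_chain2[OF DERIV_real_sqrt, rotated]) (simp add: add_pos_nonneg)
  then show ?thesis
    by (simp add: divide_simps)
qed

text \<open>With \<open>p = u'\<close> this is the curvature operator in the equation,
  in the form \<open>u'' / (1 + u'\<^sup>2)\<^sup>3\<^sup>/\<^sup>2\<close>.\<close>
lemma has_deriv_curvature_flux:
  assumes "(p has_real_derivative d) (at t)"
  shows "((\<lambda>s. p s / sqrt (1 + (p s)\<^sup>2)) has_real_derivative d / sqrt (1 + (p t)\<^sup>2) ^ 3) (at t)"
proof -
  define r where "r = sqrt (1 + (p t)\<^sup>2)"
  have r: "r > 0" "r\<^sup>2 = 1 + (p t)\<^sup>2"
    by (auto simp: r_def add_pos_nonneg)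
  have "d * r - p t * (p t * d / r) = d * (r\<^sup>2 - (p t)\<^sup>2) / r"
    using r(1) by (simp add: field_simps power2_eq_square)
  also have "\<dots> = d / r"
    using r(2) by simp
  finally have "(d * r - p t * (p t * d / r)) / (r * r) = d / r ^ 3"
    by (simp add: power3_eq_cube)
  then show ?thesis
    using DERIV_divide[OF assms has_deriv_sqrt_one_plus_square[OF assms]] r(1)
    by (simp add: r_def)
qed

text \<open>The derivative is \<open>p\<close> times that of \<open>p / sqrt (1 + p\<^sup>2)\<close>; this makes
  \<open>1 - 1 / sqrt (1 + p\<^sup>2)\<close> the kinetic part of the conserved energy.\<close>
lemma has_deriv_kinetic_energy:
  assumes "(p has_real_derivative d) (at t)"
  shows "((\<lambda>s. 1 - 1 / sqrt (1 + (p s)\<^sup>2)) has_real_derivative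
           p t * (d / sqrt (1 + (p t)\<^sup>2) ^ 3)) (at t)"
proof -
  define r where "r = sqrt (1 + (p t)\<^sup>2)"
  have r: "r > 0"
    by (auto simp: r_def add_pos_nonneg)
  have eq: "p t * (d / r ^ 3) = 0 - (0 * r - 1 * (p t * d / r)) / (r * r)"
    by (simp add: power3_eq_cube)
  have "sqrt (1 + (p t)\<^sup>2) \<noteq> 0"
    using r by (simp add: r_def)
  then show ?thesis
    unfolding r_def[symmetric] eq unfolding r_def
    by (intro DERIV_diff DERIV_const DERIV_divide has_deriv_sqrt_one_plus_square[OF assms])
qed

text \<open>The energy is constant along the solution. Its value is found along times \<open>z\<^sub>n \<longrightarrow> \<infinity>\<close> at which
  the velocity tends to 0; such times exist by the mean value theorem on \<open>[n, n + 1]\<close>, because \<open>u\<close>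
  converges.\<close>
lemma first_integral:
  fixes u W :: "real \<Rightarrow> real"
  assumes sol: "heteroclinic_solution W \<alpha> u"
    and W: "\<And>x. W differentiable (at x)" and "W \<alpha> = 0"
  shows "1 - 1 / sqrt (1 + (deriv u t)\<^sup>2) = W (u t)"
proof -
  let ?T = "\<lambda>t. 1 - 1 / sqrt (1 + (deriv u t)\<^sup>2)"
  have u': "(u has_real_derivative deriv u t) (at t)"
    and u'': "(deriv u has_real_derivative deriv (deriv u) t) (at t)" for t
    using sol by (auto simp: heteroclinic_solution_def twice_differentiable_def
        DERIV_deriv_iff_real_differentiable)
  have eq: "deriv (deriv u) t / sqrt (1 + (deriv u t)\<^sup>2) ^ 3 = deriv W (u t)" for t
    using sol DERIV_imp_deriv[OF has_deriv_curvature_flux[OF u''[of t]]]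
    by (simp add: heteroclinic_solution_def)
  have "((\<lambda>t. ?T t - W (u t)) has_real_derivative 0) (at t)" for t
  proof -
    have "((\<lambda>t. W (u t)) has_real_derivative deriv W (u t) * deriv u t) (at t)"
      using W u' by (intro DERIV_chain2[of W]) (simp_all add: DERIV_deriv_iff_real_differentiable)
    from DERIV_diff[OF has_deriv_kinetic_energy[OF u''[of t]] this]
    show ?thesis
      unfolding eq by (simp add: mult.commute)
  qed
  then have const: "?T s - W (u s) = ?T t - W (u t)" for s t
    using DERIV_isconst_all[of "\<lambda>t. ?T t - W (u t)"] by blast
  have "\<exists>z>real n. u (real n + 1) - u (real n) = deriv u z" for n
    using MVT2[of "real n" "real n + 1" u "deriv u"] u' by force
  then obtain z where z: "z n > real n" "u (real n + 1) - u (real n) = deriv u (z n)" for n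
    by metis
  have u_lim: "(u \<longlongrightarrow> \<alpha>) at_top"
    using sol by (simp add: heteroclinic_solution_def)
  have ztop: "filterlim z at_top sequentially"
    by (rule filterlim_at_top_mono[OF filterlim_real_sequentially])
       (use z in \<open>auto intro!: always_eventually less_imp_le\<close>)
  have n1top: "filterlim (\<lambda>n. real n + 1) at_top sequentially"
    by (rule filterlim_at_top_mono[OF filterlim_real_sequentially]) auto
  have "(\<lambda>n. u (real n + 1) - u (real n)) \<longlonglongrightarrow> \<alpha> - \<alpha>"
    by (intro tendsto_diff filterlim_compose[OF u_lim] n1top filterlim_real_sequentially)
  then have "(\<lambda>n. deriv u (z n)) \<longlonglongrightarrow> 0"
    using z(2) by simp
  then have "(\<lambda>n. ?T (z n)) \<longlonglongrightarrow> 1 - 1 / sqrt (1 + 0\<^sup>2)"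
    by (intro tendsto_intros) auto
  moreover have "(\<lambda>n. W (u (z n))) \<longlonglongrightarrow> W \<alpha>"
    using W by (intro isCont_tendsto_compose[of \<alpha> W] filterlim_compose[OF u_lim ztop])
       (auto intro: differentiable_imp_continuous_within)
  ultimately have "(\<lambda>n. ?T (z n) - W (u (z n))) \<longlonglongrightarrow> (1 - 1 / sqrt (1 + 0\<^sup>2)) - W \<alpha>"
    by (rule tendsto_diff)
  then have "(\<lambda>n. ?T (z n) - W (u (z n))) \<longlonglongrightarrow> 0"
    using \<open>W \<alpha> = 0\<close> by simp
  moreover have "(\<lambda>n. ?T (z n) - W (u (z n))) = (\<lambda>n. ?T t - W (u t))"
    by (rule ext) (rule const)
  ultimately have "(\<lambda>n::nat. ?T t - W (u t)) \<longlonglongrightarrow> 0"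
    by (simp only:)
  then show ?thesis
    by (simp add: LIMSEQ_const_iff)
qed

section \<open>Solutions do not reach the wells in finite time\<close>

text \<open>As long as \<open>\<bar>u\<bar> \<le> \<alpha>\<close>, the quantity \<open>\<alpha>\<^sup>2 - u\<^sup>2\<close> decays at most exponentially (a Gronwall
  argument), so it is still positive at a hypothetical first time where \<open>\<bar>u\<bar> = \<alpha>\<close>. The rate
  condition is restricted to \<open>[-\<alpha>, \<alpha>]\<close> because nothing is known of the potential elsewhere.\<close>
lemma trapped_forward:
  fixes u :: "real \<Rightarrow> real"
  assumes "\<alpha> > 0" "u 0 = 0" and u': "\<And>s. (u has_real_derivative u' s) (at s)"
    and rate: "\<And>s. \<bar>u s\<bar> \<le> \<alpha> \<Longrightarrow> \<bar>u' s\<bar> \<le> K * (\<alpha>\<^sup>2 - (u s)\<^sup>2)"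
    and "t \<ge> 0"
  shows "\<bar>u t\<bar> < \<alpha>"
proof (rule ccontr)
  assume "\<not> \<bar>u t\<bar> < \<alpha>"
  have cont: "continuous_on S u" for S
    using u' by (meson DERIV_continuous continuous_at_imp_continuous_on)
  define E where "E = {0..t} \<inter> {s. \<alpha> \<le> \<bar>u s\<bar>}"
  have "closed {s. \<alpha> \<le> \<bar>u s\<bar>}"
    by (intro closed_Collect_le continuous_intros cont)
  then have "compact E"
    unfolding E_def by (intro compact_Int_closed compact_Icc)
  moreover have "t \<in> E"
    using \<open>\<not> \<bar>u t\<bar> < \<alpha>\<close> \<open>t \<ge> 0\<close> by (auto simp: E_def)
  ultimately obtain T where "T \<in> E" and first: "\<And>s. s \<in> E \<Longrightarrow> T \<le> s"
    using continuous_attains_inf[of E "\<lambda>s. s"] by (metis continuous_on_id empty_iff)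
  then have T: "0 \<le> T" "T \<le> t" "\<alpha> \<le> \<bar>u T\<bar>"
    by (auto simp: E_def)
  have before: "\<bar>u s\<bar> < \<alpha>" if "0 \<le> s" "s < T" for s
    using first[of s] that T by (auto simp: E_def not_le[symmetric])
  let ?v = "\<lambda>s. (\<alpha>\<^sup>2 - (u s)\<^sup>2) * exp (2 * \<alpha> * K * s)"
  have "?v 0 \<le> ?v T"
  proof (rule DERIV_nonneg_imp_increasing_open[OF T(1)])
    fix s assume s: "0 < s" "s < T"
    then have lt: "\<bar>u s\<bar> < \<alpha>"
      by (intro before) auto
    \<comment> \<open>The rate condition gives \<open>(\<alpha>\<^sup>2 - u\<^sup>2)' \<ge> - 2 \<alpha> K (\<alpha>\<^sup>2 - u\<^sup>2)\<close>.\<close>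
    have "u s * u' s \<le> \<bar>u s\<bar> * \<bar>u' s\<bar>"
      by (metis abs_ge_self abs_mult)
    also have "\<dots> \<le> \<alpha> * (K * (\<alpha>\<^sup>2 - (u s)\<^sup>2))"
      using lt rate[of s] by (intro mult_mono) auto
    finally have "0 \<le> 2 * \<alpha> * K * (\<alpha>\<^sup>2 - (u s)\<^sup>2) - 2 * u s * u' s"
      by simp
    then have "0 \<le> (2 * \<alpha> * K * (\<alpha>\<^sup>2 - (u s)\<^sup>2) - 2 * u s * u' s) * exp (2 * \<alpha> * K * s)"
      by simp
    moreover have "(?v has_real_derivative
        (2 * \<alpha> * K * (\<alpha>\<^sup>2 - (u s)\<^sup>2) - 2 * u s * u' s) * exp (2 * \<alpha> * K * s)) (at s)"
      by (auto intro!: derivative_eq_intros u' simp: algebra_simps)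
    ultimately show "\<exists>y. (?v has_real_derivative y) (at s) \<and> y \<ge> 0"
      by blast
  qed (intro continuous_intros cont)
  moreover have "\<alpha>\<^sup>2 \<le> (u T)\<^sup>2"
    using T(3) \<open>\<alpha> > 0\<close> by (simp add: abs_le_square_iff[symmetric])
  then have "?v T \<le> 0"
    by (simp add: mult_nonpos_nonneg)
  ultimately have "?v 0 \<le> 0"
    by (rule order_trans)
  then have "\<alpha>\<^sup>2 \<le> 0"
    using \<open>u 0 = 0\<close> by simp
  then show False
    using \<open>\<alpha> > 0\<close> by simp
qed

lemma trapped:
  fixes u :: "real \<Rightarrow> real"
  assumes "\<alpha> > 0" "u 0 = 0" and u': "\<And>s. (u has_real_derivative u' s) (at s)"
    and rate: "\<And>s. \<bar>u s\<bar> \<le> \<alpha> \<Longrightarrow> \<bar>u' s\<bar> \<le> K * (\<alpha>\<^sup>2 - (u s)\<^sup>2)"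
  shows "\<bar>u t\<bar> < \<alpha>"
proof (cases "t \<ge> 0")
  case True
  then show ?thesis
    using trapped_forward[OF assms] by blast
next
  case False
  have "\<bar>u (- (- t))\<bar> < \<alpha>"
  proof (rule trapped_forward[where u = "\<lambda>s. u (- s)" and u' = "\<lambda>s. - u' (- s)"])
    show "((\<lambda>s. u (- s)) has_real_derivative - u' (- s)) (at s)" for s
      using u'[of "- s"] by (rule DERIV_mirror[THEN iffD1])
  qed (use assms False in auto)
  then show ?thesis
    by simp
qed

section \<open>Comparison of the potential with a quartic\<close>

text \<open>The derivative of \<open>(\<alpha>\<^sup>2 - x\<^sup>2)\<^sup>2\<close> is \<open>-4 x (\<alpha> - x) (\<alpha> + x)\<close> with \<open>\<alpha> \<le> \<alpha> + x \<le> 2 \<alpha>\<close>. The constants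
  are chosen so that subtracting the multiple of the quartic leaves a monotone function that vanishes
  at \<open>\<alpha>\<close>.\<close>
lemma quartic_bounds_right:
  fixes W :: "real \<Rightarrow> real"
  assumes "\<alpha> > 0" and W': "\<And>x. (W has_real_derivative W' x) (at x)" and "W \<alpha> = 0"
    and bounds: "\<And>x. 0 \<le> x \<Longrightarrow> x \<le> \<alpha> \<Longrightarrow>
        - a * x * (\<alpha> - x) \<le> W' x \<and> W' x \<le> - b * x * (\<alpha> - x)"
    and "a \<ge> 0" "b \<ge> 0" and x: "0 \<le> x" "x \<le> \<alpha>"
  shows "W x \<le> a / (4 * \<alpha>) * (\<alpha>\<^sup>2 - x\<^sup>2)\<^sup>2" and "b / (8 * \<alpha>) * (\<alpha>\<^sup>2 - x\<^sup>2)\<^sup>2 \<le> W x"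
proof -
  let ?h = "\<lambda>c s. W s - c * (\<alpha>\<^sup>2 - s\<^sup>2)\<^sup>2"
  have h': "(?h c has_real_derivative W' s + 4 * c * s * (\<alpha> - s) * (\<alpha> + s)) (at s)" for c s
    by (auto intro!: derivative_eq_intros W' simp: algebra_simps power2_eq_square)
  have "?h (a / (4 * \<alpha>)) x \<le> ?h (a / (4 * \<alpha>)) \<alpha>"
  proof (rule DERIV_nonneg_imp_nondecreasing[OF x(2)])
    fix s assume "x \<le> s" "s \<le> \<alpha>"
    with x have s: "0 \<le> s" "s \<le> \<alpha>" by auto
    have "a * s * (\<alpha> - s) * \<alpha> \<le> a * s * (\<alpha> - s) * (\<alpha> + s)"
      using s \<open>a \<ge> 0\<close> by (intro mult_left_mono) auto
    then have "a * s * (\<alpha> - s) \<le> 4 * (a / (4 * \<alpha>)) * s * (\<alpha> - s) * (\<alpha> + s)"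
      using \<open>\<alpha> > 0\<close> by (simp add: field_simps)
    with bounds[OF s] h' show "\<exists>y. (?h (a / (4 * \<alpha>)) has_real_derivative y) (at s) \<and> 0 \<le> y"
      by (intro exI conjI) (auto simp del: times_divide_eq_left times_divide_eq_right)
  qed
  then show "W x \<le> a / (4 * \<alpha>) * (\<alpha>\<^sup>2 - x\<^sup>2)\<^sup>2"
    using \<open>W \<alpha> = 0\<close> by simp
  have "?h (b / (8 * \<alpha>)) x \<ge> ?h (b / (8 * \<alpha>)) \<alpha>"
  proof (rule DERIV_nonpos_imp_nonincreasing[OF x(2)])
    fix s assume "x \<le> s" "s \<le> \<alpha>"
    with x have s: "0 \<le> s" "s \<le> \<alpha>" by auto
    have "b * s * (\<alpha> - s) * (\<alpha> + s) \<le> b * s * (\<alpha> - s) * (2 * \<alpha>)"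
      using s \<open>b \<ge> 0\<close> by (intro mult_left_mono) auto
    then have "4 * (b / (8 * \<alpha>)) * s * (\<alpha> - s) * (\<alpha> + s) \<le> b * s * (\<alpha> - s)"
      using \<open>\<alpha> > 0\<close> by (simp add: field_simps)
    with bounds[OF s] h' show "\<exists>y. (?h (b / (8 * \<alpha>)) has_real_derivative y) (at s) \<and> y \<le> 0"
      by (intro exI conjI) (auto simp del: times_divide_eq_left times_divide_eq_right)
  qed
  then show "b / (8 * \<alpha>) * (\<alpha>\<^sup>2 - x\<^sup>2)\<^sup>2 \<le> W x"
    using \<open>W \<alpha> = 0\<close> by simp
qed

lemma quartic_bounds:
  fixes W :: "real \<Rightarrow> real"
  assumes "\<alpha> > 0" and W: "\<And>x. W differentiable (at x)" and zeros: "W \<alpha> = 0" "W (- \<alpha>) = 0"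
    and right: "\<And>x. 0 \<le> x \<Longrightarrow> x \<le> \<alpha> \<Longrightarrow>
        - a * x * (\<alpha> - x) \<le> deriv W x \<and> deriv W x \<le> - b * x * (\<alpha> - x)"
    and left: "\<And>x. 0 \<le> x \<Longrightarrow> x \<le> \<alpha> \<Longrightarrow>
        b * x * (\<alpha> - x) \<le> deriv W (- x) \<and> deriv W (- x) \<le> a * x * (\<alpha> - x)"
    and "a \<ge> 0" "b \<ge> 0" and x: "\<bar>x\<bar> \<le> \<alpha>"
  shows "W x \<le> a / (4 * \<alpha>) * (\<alpha>\<^sup>2 - x\<^sup>2)\<^sup>2" and "b / (8 * \<alpha>) * (\<alpha>\<^sup>2 - x\<^sup>2)\<^sup>2 \<le> W x"
proof -
  have W': "(W has_real_derivative deriv W y) (at y)" for y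
    using W by (simp add: DERIV_deriv_iff_real_differentiable)
  have W'_refl: "((\<lambda>y. W (- y)) has_real_derivative - deriv W (- y)) (at y)" for y
    by (intro DERIV_mirror[THEN iffD1] W')
  have "W x \<le> a / (4 * \<alpha>) * (\<alpha>\<^sup>2 - x\<^sup>2)\<^sup>2 \<and> b / (8 * \<alpha>) * (\<alpha>\<^sup>2 - x\<^sup>2)\<^sup>2 \<le> W x"
  proof (cases "x \<ge> 0")
    case True
    then show ?thesis
      using quartic_bounds_right[OF \<open>\<alpha> > 0\<close> W' zeros(1) right \<open>a \<ge> 0\<close> \<open>b \<ge> 0\<close>] x by auto
  next
    case False
    have "- a * y * (\<alpha> - y) \<le> - deriv W (- y) \<and> - deriv W (- y) \<le> - b * y * (\<alpha> - y)"
      if "0 \<le> y" "y \<le> \<alpha>" for y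
      using left[OF that] by auto
    from quartic_bounds_right[OF \<open>\<alpha> > 0\<close> W'_refl zeros(2) this \<open>a \<ge> 0\<close> \<open>b \<ge> 0\<close>, of "- x"]
    show ?thesis
      using x False by auto
  qed
  then show "W x \<le> a / (4 * \<alpha>) * (\<alpha>\<^sup>2 - x\<^sup>2)\<^sup>2" and "b / (8 * \<alpha>) * (\<alpha>\<^sup>2 - x\<^sup>2)\<^sup>2 \<le> W x"
    by auto
qed

section \<open>Boundedness and regularity of the velocity\<close>

text \<open>For a continuous function the set where \<open>\<bar>f\<bar>\<close> is at most the essential supremum is closed and of
  full measure, hence everything. The bound \<open>B\<close> excludes an infinite essential supremum, whose
  real value would be 0.\<close>
lemma abs_le_Linf_norm:
  assumes cont: "continuous_on UNIV f" and bdd: "\<And>t. \<bar>f t\<bar> \<le> B"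
  shows "\<bar>f t\<bar> \<le> Linf_norm f"
proof -
  let ?g = "\<lambda>t. ereal \<bar>f t\<bar>"
  have meas: "?g \<in> borel_measurable lebesgue"
    using borel_measurable_continuous_onI[OF cont] by (auto intro!: measurable_completion)
  let ?S = "esssup lebesgue ?g"
  have closed: "closed {t. ?g t \<le> ?S}"
  proof (rule closed_Collect_le)
    show "continuous_on UNIV ?g"
      by (intro continuous_on_ereal continuous_intros cont)
  qed auto
  have le: "?g t \<le> ?S" for t
    using mem_closed_if_AE_lebesgue[OF closed] esssup_AE[of ?g lebesgue] by auto
  moreover have "?S \<le> ereal B"
    using bdd by (intro esssup_I[OF meas]) auto
  ultimately obtain r where "?S = ereal r"
    using le[of 0] by (cases ?S) auto
  then show ?thesis
    using le[of t] by (simp add: Linf_norm_def)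
qed

text \<open>For \<open>\<bar>s - t\<bar> \<le> 1\<close> the Lipschitz bound suffices, since \<open>\<bar>s - t\<bar>\<close> is at most its
  square root; otherwise the uniform bound does.\<close>
lemma bounded_lipschitz_imp_Holder_half:
  fixes p :: "real \<Rightarrow> real"
  assumes bdd: "\<And>t. \<bar>p t\<bar> \<le> B" and lip: "\<And>s t. \<bar>p s - p t\<bar> \<le> L * \<bar>s - t\<bar>" and "L \<ge> 0"
  shows "\<bar>p s - p t\<bar> \<le> (L + 2 * B) * \<bar>s - t\<bar> powr (1 / 2)"
proof -
  have B: "B \<ge> 0"
    using bdd[of 0] by linarith
  let ?r = "sqrt \<bar>s - t\<bar>"
  have "\<bar>p s - p t\<bar> \<le> (L + 2 * B) * ?r"
  proof (cases "?r \<le> 1")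
    case True
    have "\<bar>s - t\<bar> = ?r * ?r"
      by simp
    also have "\<dots> \<le> ?r * 1"
      using True by (intro mult_left_mono) auto
    finally have "L * \<bar>s - t\<bar> \<le> L * ?r"
      using \<open>L \<ge> 0\<close> by (intro mult_left_mono) auto
    moreover have "0 \<le> 2 * B * ?r"
      using B by simp
    ultimately show ?thesis
      using lip[of s t] by (simp add: distrib_right)
  next
    case False
    then have "2 * B * 1 \<le> 2 * B * ?r"
      using B by (intro mult_left_mono) auto
    moreover have "0 \<le> L * ?r"
      using \<open>L \<ge> 0\<close> by simp
    ultimately show ?thesis
      using bdd[of s] bdd[of t] by (simp add: distrib_right)
  qed
  then show ?thesis
    by (simp add: powr_half_sqrt)
qed

section \<open>The velocity as a function of the position\<close>

text \<open>The modulus \<open>\<bar>p\<bar>\<close> obtained by solving the energy identity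
  \<open>1 - 1 / sqrt (1 + p\<^sup>2) = W x\<close>.\<close>
definition speed :: "(real \<Rightarrow> real) \<Rightarrow> real \<Rightarrow> real" where
  "speed W x = sqrt (1 / (1 - W x)\<^sup>2 - 1)"

lemma sqrt_one_plus_speed_square:
  assumes "0 \<le> W x" "W x < 1"
  shows "sqrt (1 + (speed W x)\<^sup>2) = 1 / (1 - W x)"
proof -
  have "(1 - W x)\<^sup>2 \<le> 1"
    using assms by (simp add: power_le_one)
  then have "1 / (1 - W x)\<^sup>2 - 1 \<ge> 0"
    using assms by simp
  then have "1 + (speed W x)\<^sup>2 = (1 / (1 - W x))\<^sup>2"
    by (simp add: speed_def power_divide)
  then show ?thesis
    using assms by simp
qed

text \<open>With \<open>w = W x\<close> the squared speed is \<open>2 w (1 - w / 2) / (1 - w)\<^sup>2\<close>. The factor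
  \<open>(1 - w / 2) / (1 - w)\<^sup>2\<close> is at least 1 for \<open>w \<le> 1 / 2\<close> and at most \<open>1 / (1 - w)\<^sup>2\<close>, which is 1 plus
  the squared speed. Bounding the speed by itself in this way is what lets \<open>\<kappa>\<close> depend on the
  supremum of the velocity.\<close>
lemma speed_bounds:
  assumes "0 \<le> W x" "W x \<le> 1 / 2"
  shows "sqrt (2 * W x) \<le> speed W x"
    and "speed W x \<le> sqrt (2 * W x) * sqrt (1 + (speed W x)\<^sup>2)"
proof -
  define w where "w = W x"
  have w: "0 \<le> w" "w \<le> 1 / 2"
    using assms by (auto simp: w_def)
  have "w * (2 - w) = 1 - (1 - w)\<^sup>2"
    by (simp add: power2_eq_square algebra_simps)
  then have eq: "1 / (1 - w)\<^sup>2 - 1 = w * (2 - w) / (1 - w)\<^sup>2"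
    using w by (simp add: diff_divide_distrib)
  have "2 * (1 - w)\<^sup>2 \<le> 2 - w"
    using w mult_left_mono[of w 1 w] by (simp add: power2_eq_square algebra_simps)
  then have "w * (2 * (1 - w)\<^sup>2) \<le> w * (2 - w)"
    using w by (intro mult_left_mono)
  then have "2 * w \<le> 1 / (1 - w)\<^sup>2 - 1"
    unfolding eq using w by (simp add: pos_le_divide_eq mult.commute mult.left_commute)
  then show "sqrt (2 * W x) \<le> speed W x"
    by (simp add: speed_def w_def)
  have "w * (2 - w) \<le> 2 * w"
    using w by (simp add: algebra_simps)
  then have "1 / (1 - w)\<^sup>2 - 1 \<le> 2 * w / (1 - w)\<^sup>2"
    unfolding eq by (intro divide_right_mono) auto
  then have "speed W x \<le> sqrt (2 * w / (1 - w)\<^sup>2)"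
    by (simp add: speed_def w_def)
  also have "\<dots> = sqrt (2 * w) * (1 / (1 - w))"
    using w by (simp add: real_sqrt_divide)
  also have "\<dots> = sqrt (2 * W x) * sqrt (1 + (speed W x)\<^sup>2)"
    using sqrt_one_plus_speed_square[of W x] w by (simp add: w_def)
  finally show "speed W x \<le> sqrt (2 * W x) * sqrt (1 + (speed W x)\<^sup>2)" .
qed

text \<open>What the argument uses of a single potential of the family. The normalisations 2 and 8 are those
  for which \<open>sqrt (2 W) \<le> speed \<le> sqrt (8 W)\<close> turns the two quartic bounds into
  \<open>k (\<alpha>\<^sup>2 - x\<^sup>2) \<le> speed \<le> K (\<alpha>\<^sup>2 - x\<^sup>2)\<close>; the second half holds because \<open>W \<le> 1 / 2\<close> keeps
  \<open>sqrt (1 + speed\<^sup>2) = 1 / (1 - W)\<close> at most 2.\<close>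
locale shallow_double_well =
  fixes W :: "real \<Rightarrow> real" and \<alpha> k K M :: real
  assumes \<alpha>_pos: "\<alpha> > 0" and k_pos: "k > 0" and K_pos: "K > 0"
    and differentiable: "\<And>x. W differentiable (at x)"
    and deriv_bound: "\<And>x. \<bar>x\<bar> \<le> \<alpha> \<Longrightarrow> \<bar>deriv W x\<bar> \<le> M"
    and lower: "\<And>x. \<bar>x\<bar> \<le> \<alpha> \<Longrightarrow> k\<^sup>2 * (\<alpha>\<^sup>2 - x\<^sup>2)\<^sup>2 \<le> 2 * W x"
    and upper: "\<And>x. \<bar>x\<bar> \<le> \<alpha> \<Longrightarrow> 8 * W x \<le> K\<^sup>2 * (\<alpha>\<^sup>2 - x\<^sup>2)\<^sup>2"
    and shallow: "\<And>x. \<bar>x\<bar> \<le> \<alpha> \<Longrightarrow> W x \<le> 1 / 2"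
begin

lemma nonneg: "\<bar>x\<bar> \<le> \<alpha> \<Longrightarrow> 0 \<le> W x"
  using lower[of x] by (smt (verit) mult_nonneg_nonneg zero_le_power2)

lemma square_diff_nonneg: "\<bar>x\<bar> \<le> \<alpha> \<Longrightarrow> 0 \<le> \<alpha>\<^sup>2 - x\<^sup>2"
  using abs_le_square_iff[of x \<alpha>] by simp

lemma square_diff_pos: "\<bar>x\<bar> < \<alpha> \<Longrightarrow> 0 < \<alpha>\<^sup>2 - x\<^sup>2"
  using power2_strict_mono[of x \<alpha>] by simp

lemma speed_ge: "\<bar>x\<bar> \<le> \<alpha> \<Longrightarrow> k * (\<alpha>\<^sup>2 - x\<^sup>2) \<le> speed W x"
proof -
  assume x: "\<bar>x\<bar> \<le> \<alpha>"
  have "k * (\<alpha>\<^sup>2 - x\<^sup>2) \<le> sqrt (2 * W x)"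
    using lower[OF x] by (intro real_le_rsqrt) (simp add: power_mult_distrib)
  with speed_bounds(1)[of W x] nonneg[OF x] shallow[OF x] show ?thesis
    by linarith
qed

lemma sqrt_one_plus_speed_square_le: "\<bar>x\<bar> \<le> \<alpha> \<Longrightarrow> sqrt (1 + (speed W x)\<^sup>2) \<le> 2"
  using nonneg[of x] shallow[of x] by (simp add: sqrt_one_plus_speed_square field_simps)

lemma speed_le: "\<bar>x\<bar> \<le> \<alpha> \<Longrightarrow> speed W x \<le> K * (\<alpha>\<^sup>2 - x\<^sup>2)"
proof -
  assume x: "\<bar>x\<bar> \<le> \<alpha>"
  have "speed W x \<le> sqrt (2 * W x) * sqrt (1 + (speed W x)\<^sup>2)"
    using nonneg[OF x] shallow[OF x] by (rule speed_bounds(2))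
  also have "\<dots> \<le> sqrt (2 * W x) * 2"
    using sqrt_one_plus_speed_square_le[OF x] nonneg[OF x] by (intro mult_left_mono) auto
  also have "\<dots> \<le> K * (\<alpha>\<^sup>2 - x\<^sup>2)"
  proof (rule power2_le_imp_le)
    show "(sqrt (2 * W x) * 2)\<^sup>2 \<le> (K * (\<alpha>\<^sup>2 - x\<^sup>2))\<^sup>2"
      using upper[OF x] nonneg[OF x] by (simp add: power_mult_distrib)
  qed (use K_pos square_diff_nonneg[OF x] in auto)
  finally show ?thesis .
qed

lemma speed_pos: "\<bar>x\<bar> < \<alpha> \<Longrightarrow> 0 < speed W x"
  using speed_ge[of x] square_diff_pos[of x] k_pos by (smt (verit) mult_pos_pos)

lemma speed_differentiable:
  assumes "\<bar>x\<bar> < \<alpha>"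
  shows "speed W differentiable (at x)"
proof -
  have "1 - W x \<noteq> 0"
    using shallow[of x] assms by auto
  then have "(\<lambda>x. 1 / (1 - W x)\<^sup>2 - 1) differentiable (at x)"
    by (intro derivative_intros differentiable) auto
  then obtain d where d: "((\<lambda>x. 1 / (1 - W x)\<^sup>2 - 1) has_real_derivative d) (at x)"
    using real_differentiable_def by blast
  have "1 / (1 - W x)\<^sup>2 - 1 > 0"
    using speed_pos[OF assms] by (simp add: speed_def)
  then have "((\<lambda>x. sqrt (1 / (1 - W x)\<^sup>2 - 1)) has_real_derivative
      inverse (sqrt (1 / (1 - W x)\<^sup>2 - 1)) / 2 * d) (at x)"
    by (rule DERIV_chain2[OF DERIV_real_sqrt]) (rule d)
  then show ?thesis
    unfolding speed_def[abs_def] using real_differentiable_def by blast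
qed

end

section \<open>Orbits of the first-order equation\<close>

text \<open>The first-order form of the heteroclinic problem.\<close>
locale speed_orbit = shallow_double_well +
  fixes u :: "real \<Rightarrow> real"
  assumes start: "u 0 = 0" and inside: "\<And>t. \<bar>u t\<bar> < \<alpha>"
    and velocity: "\<And>t. (u has_real_derivative speed W (u t)) (at t)"
begin

lemma inside_le: "\<bar>u t\<bar> \<le> \<alpha>"
  using inside[of t] by simp

lemma reflected_velocity: "((\<lambda>s. - u (- s)) has_real_derivative speed W (u (- t))) (at t)"
  using DERIV_minus[OF DERIV_mirror[THEN iffD1, OF velocity[of "- t"]]] by simp

text \<open>The odd reflection of an orbit is an orbit for the reflected potential, so estimates for
  negative times follow from those for positive times.\<close>
lemma reflected: "speed_orbit (\<lambda>x. W (- x)) \<alpha> k K M (\<lambda>t. - u (- t))"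
proof unfold_locales
  fix x
  have W': "((\<lambda>x. W (- x)) has_real_derivative - deriv W (- x)) (at x)"
    using differentiable
    by (intro DERIV_mirror[THEN iffD1]) (simp add: DERIV_deriv_iff_real_differentiable)
  then show "(\<lambda>x. W (- x)) differentiable (at x)"
    using real_differentiable_def by blast
  show "\<bar>x\<bar> \<le> \<alpha> \<Longrightarrow> \<bar>deriv (\<lambda>x. W (- x)) x\<bar> \<le> M"
    using deriv_bound[of "-x"] DERIV_imp_deriv[OF W'] by simp
qed (use \<alpha>_pos k_pos K_pos lower[of "- _"] upper[of "- _"] shallow[of "- _"] start inside
      reflected_velocity in \<open>auto simp: speed_def\<close>)

lemma tanh_le: "t \<ge> 0 \<Longrightarrow> \<alpha> * tanh (\<alpha> * k * t) \<le> u t"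
  by (rule tanh_le_of_rate_ge[OF \<alpha>_pos start inside velocity speed_ge[OF inside_le]])

lemma tendsto_right: "(u \<longlongrightarrow> \<alpha>) at_top"
proof (rule tendsto_sandwich)
  show "\<forall>\<^sub>F t in at_top. \<alpha> * tanh (\<alpha> * k * t) \<le> u t"
    using eventually_ge_at_top[of 0] by eventually_elim (rule tanh_le)
  show "\<forall>\<^sub>F t in at_top. u t \<le> \<alpha>"
    using inside_le by (auto simp: abs_le_iff)
  have "filterlim (\<lambda>t. \<alpha> * k * t) at_top at_top"
    using \<alpha>_pos k_pos by (intro filterlim_tendsto_pos_mult_at_top[OF tendsto_const] filterlim_ident) auto
  then have "((\<lambda>t. \<alpha> * tanh (\<alpha> * k * t)) \<longlongrightarrow> \<alpha> * 1) at_top"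
    by (intro tendsto_mult tendsto_const filterlim_compose[OF tanh_real_at_top])
  then show "((\<lambda>t. \<alpha> * tanh (\<alpha> * k * t)) \<longlongrightarrow> \<alpha>) at_top"
    by simp
qed simp

lemma tendsto_left: "(u \<longlongrightarrow> - \<alpha>) at_bot"
  using tendsto_minus[OF speed_orbit.tendsto_right[OF reflected]]
  by (simp add: filterlim_at_bot_mirror)

lemma gap_decay: "t \<ge> 0 \<Longrightarrow> \<alpha> - u t \<le> 2 * \<alpha> * exp (- (2 * \<alpha> * k) * t)"
  using tanh_le[of t] mult_left_mono[OF one_minus_tanh_le[of "\<alpha> * k * t"], of \<alpha>] \<alpha>_pos
  by (simp add: algebra_simps)

lemma velocity_le_gap: "speed W (u t) \<le> 2 * \<alpha> * K * (\<alpha> - u t)"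
proof -
  have "speed W (u t) \<le> K * (\<alpha>\<^sup>2 - (u t)\<^sup>2)"
    by (rule speed_le[OF inside_le])
  also have "\<dots> = K * ((\<alpha> - u t) * (\<alpha> + u t))"
    by (simp add: algebra_simps power2_eq_square)
  also have "\<dots> \<le> K * ((\<alpha> - u t) * (2 * \<alpha>))"
    using K_pos inside[of t] by (intro mult_left_mono) auto
  finally show ?thesis
    by (simp add: algebra_simps)
qed

lemma velocity_decay: "t \<ge> 0 \<Longrightarrow> speed W (u t) \<le> 4 * \<alpha>\<^sup>2 * K * exp (- (2 * \<alpha> * k) * t)"
proof -
  assume "t \<ge> 0"
  have "speed W (u t) \<le> 2 * \<alpha> * K * (\<alpha> - u t)"
    by (rule velocity_le_gap)
  also have "\<dots> \<le> 2 * \<alpha> * K * (2 * \<alpha> * exp (- (2 * \<alpha> * k) * t))"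
    using gap_decay[OF \<open>t \<ge> 0\<close>] \<alpha>_pos K_pos by (intro mult_left_mono) auto
  finally show ?thesis
    by (simp add: power2_eq_square mult_ac)
qed

lemma deriv_eq: "deriv u = (\<lambda>t. speed W (u t))"
  using velocity by (auto intro: DERIV_imp_deriv)

lemma deriv_deriv: "(deriv u has_real_derivative deriv (deriv u) t) (at t)"
proof -
  have "(speed W has_real_derivative deriv (speed W) (u t)) (at (u t))"
    using speed_differentiable[OF inside] by (simp add: DERIV_deriv_iff_real_differentiable)
  then have "(deriv u has_real_derivative deriv (speed W) (u t) * speed W (u t)) (at t)"
    unfolding deriv_eq by (rule DERIV_chain2) (rule velocity)
  then show ?thesis
    using DERIV_imp_deriv by fastforce
qed

text \<open>Along the orbit the kinetic energy equals \<open>W(u)\<close> identically. Differentiating this identity gives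
  the equation multiplied by \<open>u'\<close>, and \<open>u'\<close> does not vanish.\<close>
lemma euler_lagrange: "deriv (deriv u) t / sqrt (1 + (deriv u t)\<^sup>2) ^ 3 = deriv W (u t)"
proof -
  have "1 - 1 / sqrt (1 + (deriv u s)\<^sup>2) = W (u s)" for s
  proof -
    have "W (u s) < 1"
      using shallow[OF inside_le[of s]] by simp
    then show ?thesis
      using sqrt_one_plus_speed_square[of W "u s"] nonneg[OF inside_le] by (simp add: deriv_eq)
  qed
  then have "((\<lambda>s. W (u s)) has_real_derivative
      deriv u t * (deriv (deriv u) t / sqrt (1 + (deriv u t)\<^sup>2) ^ 3)) (at t)"
    using has_deriv_kinetic_energy[OF deriv_deriv[of t]] by simp
  moreover have "((\<lambda>s. W (u s)) has_real_derivative deriv W (u t) * deriv u t) (at t)"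
    using differentiable velocity[of t]
    by (intro DERIV_chain2[of W]) (simp_all add: DERIV_deriv_iff_real_differentiable deriv_eq)
  ultimately have "deriv u t * (deriv (deriv u) t / sqrt (1 + (deriv u t)\<^sup>2) ^ 3)
      = deriv u t * deriv W (u t)"
    using DERIV_unique by (fastforce simp: mult.commute)
  moreover have "deriv u t \<noteq> 0"
    using speed_pos[OF inside[of t]] by (simp add: deriv_eq)
  ultimately show ?thesis
    by (metis mult_left_cancel)
qed

lemma velocity_bounded: "\<bar>deriv u t\<bar> \<le> K * \<alpha>\<^sup>2"
proof -
  have "speed W (u t) \<le> K * (\<alpha>\<^sup>2 - (u t)\<^sup>2)"
    by (rule speed_le[OF inside_le])
  also have "\<dots> \<le> K * \<alpha>\<^sup>2"
    using K_pos by simp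
  finally show ?thesis
    using speed_pos[OF inside[of t]] by (simp add: deriv_eq)
qed

text \<open>The equation gives \<open>u'' = W'(u) (1 + u'\<^sup>2)\<^sup>3\<^sup>/\<^sup>2\<close>, which is bounded by \<open>8 M\<close>; so \<open>u'\<close> is globally
  Lipschitz, and it is bounded as well.\<close>
lemma C1_Holder: "C1_Holder_loc (1 / 2) u"
proof -
  have M: "M \<ge> 0"
    using deriv_bound[of 0] \<alpha>_pos by auto
  have "\<bar>deriv (deriv u) t\<bar> \<le> 8 * M" for t
  proof -
    let ?r = "sqrt (1 + (deriv u t)\<^sup>2)"
    have r: "0 < ?r" "?r \<le> 2"
      using sqrt_one_plus_speed_square_le[OF inside_le] by (auto simp: deriv_eq add_pos_nonneg)
    then have "?r ^ 3 \<le> 2 ^ 3"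
      by (intro power_mono) auto
    have "deriv (deriv u) t = deriv W (u t) * ?r ^ 3"
      using euler_lagrange[of t] r by (simp add: field_simps)
    then have "\<bar>deriv (deriv u) t\<bar> = \<bar>deriv W (u t)\<bar> * ?r ^ 3"
      using r by (simp add: abs_mult)
    also have "\<dots> \<le> M * 2 ^ 3"
      using deriv_bound[OF inside_le] \<open>?r ^ 3 \<le> 2 ^ 3\<close> M r by (intro mult_mono) auto
    finally show ?thesis
      by simp
  qed
  then have "\<bar>deriv u s - deriv u t\<bar> \<le> 8 * M * \<bar>s - t\<bar>" for s t
    using field_differentiable_bound[of UNIV "deriv u" "deriv (deriv u)" "8 * M" s t] deriv_deriv
    by simp
  then have "\<bar>deriv u s - deriv u t\<bar> \<le> (8 * M + 2 * (K * \<alpha>\<^sup>2)) * \<bar>s - t\<bar> powr (1 / 2)" for s t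
    using M by (intro bounded_lipschitz_imp_Holder_half velocity_bounded) auto
  moreover have "u differentiable (at t)" for t
    using velocity real_differentiable_def by blast
  ultimately show ?thesis
    unfolding C1_Holder_loc_def by blast
qed


lemma gap_decay_left: "t \<le> 0 \<Longrightarrow> \<alpha> + u t \<le> 2 * \<alpha> * exp (2 * \<alpha> * k * t)"
  using speed_orbit.gap_decay[OF reflected, of "- t"] by simp

lemma velocity_decay_left: "t \<le> 0 \<Longrightarrow> speed W (u t) \<le> 4 * \<alpha>\<^sup>2 * K * exp (2 * \<alpha> * k * t)"
  using speed_orbit.velocity_decay[OF reflected, of "- t"] by (simp add: speed_def)

lemma heteroclinic: "heteroclinic_solution W \<alpha> u"
proof -
  have "- deriv (\<lambda>s. deriv u s / sqrt (1 + (deriv u s)\<^sup>2)) t + deriv W (u t) = 0" for t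
    using DERIV_imp_deriv[OF has_deriv_curvature_flux[OF deriv_deriv[of t]]] euler_lagrange[of t]
    by simp
  moreover have "u differentiable (at t)" "deriv u differentiable (at t)" for t
    using velocity[of t] deriv_deriv[of t] real_differentiable_def by blast+
  ultimately show ?thesis
    using start tendsto_right tendsto_left
    by (simp add: heteroclinic_solution_def twice_differentiable_def)
qed

text \<open>Here \<open>sqrt (2 W(u)) = sqrt 2 (\<alpha>\<^sup>2 - u\<^sup>2)\<close>, so the two bounds on the speed are themselves
  Riccati rates; in the upper one the speed under the root is replaced by its supremum.\<close>
lemma quartic_tanh_bounds:
  assumes W: "\<And>x. W x = (x\<^sup>2 - \<alpha>\<^sup>2)\<^sup>2" and "t \<ge> 0"
  shows "\<alpha> * tanh (\<alpha> * sqrt 2 * t) \<le> u t"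
    and "u t \<le> \<alpha> * tanh (\<alpha> * sqrt 2 * t / (1 / sqrt (1 + (Linf_norm (deriv u))\<^sup>2)))"
proof -
  have sqrt_W: "sqrt (2 * W (u s)) = sqrt 2 * (\<alpha>\<^sup>2 - (u s)\<^sup>2)" for s
    using square_diff_nonneg[OF inside_le] by (simp add: W real_sqrt_mult abs_minus_commute)
  have bounds: "0 \<le> W (u s)" "W (u s) \<le> 1 / 2" for s
    using nonneg shallow inside_le by auto
  show "\<alpha> * tanh (\<alpha> * sqrt 2 * t) \<le> u t"
    using tanh_le_of_rate_ge[OF \<alpha>_pos start inside velocity, of "sqrt 2"]
      speed_bounds(1)[of W, OF bounds] sqrt_W \<open>t \<ge> 0\<close> by simp
  let ?L = "Linf_norm (deriv u)"
  have "continuous_on UNIV (deriv u)"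
    using deriv_deriv by (meson DERIV_continuous continuous_at_imp_continuous_on)
  then have L: "\<bar>deriv u s\<bar> \<le> ?L" for s
    using velocity_bounded by (rule abs_le_Linf_norm)
  have "speed W (u s) \<le> sqrt 2 * sqrt (1 + ?L\<^sup>2) * (\<alpha>\<^sup>2 - (u s)\<^sup>2)" for s
  proof -
    have "(speed W (u s))\<^sup>2 \<le> ?L\<^sup>2"
      using L[of s] by (simp add: deriv_eq abs_le_square_iff[symmetric])
    have "speed W (u s) \<le> sqrt (2 * W (u s)) * sqrt (1 + (speed W (u s))\<^sup>2)"
      using bounds by (rule speed_bounds(2))
    also have "\<dots> \<le> sqrt (2 * W (u s)) * sqrt (1 + ?L\<^sup>2)"
      using \<open>(speed W (u s))\<^sup>2 \<le> ?L\<^sup>2\<close> bounds by (intro mult_left_mono) auto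
    finally show ?thesis
      unfolding sqrt_W by (simp add: mult_ac)
  qed
  from le_tanh_of_rate_le[OF \<alpha>_pos start inside velocity this \<open>t \<ge> 0\<close>]
  show "u t \<le> \<alpha> * tanh (\<alpha> * sqrt 2 * t / (1 / sqrt (1 + ?L\<^sup>2)))"
    by (simp add: mult_ac)
qed

end

section \<open>Equivalence with the second-order problem\<close>

context shallow_double_well
begin

text \<open>The energy identity gives \<open>\<bar>u'\<bar> = speed\<close> while \<open>u\<close> is in \<open>[-\<alpha>, \<alpha>]\<close>; the speed estimate keeps
  \<open>u\<close> strictly inside, where the speed is positive. Hence \<open>u'\<close> has constant sign, and a negative
  sign is incompatible with \<open>u(0) = 0\<close> and the limit \<open>\<alpha> > 0\<close>.\<close>
lemma heteroclinic_imp_speed_orbit: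
  assumes sol: "heteroclinic_solution W \<alpha> u"
  shows "speed_orbit W \<alpha> k K M u"
proof -
  have start: "u 0 = 0" and u_lim: "(u \<longlongrightarrow> \<alpha>) at_top"
    and u': "(u has_real_derivative deriv u t) (at t)"
    and u''_ex: "deriv u differentiable (at t)" for t
    using sol by (auto simp: heteroclinic_solution_def twice_differentiable_def
        DERIV_deriv_iff_real_differentiable)
  have "W \<alpha> = 0"
    using nonneg[of \<alpha>] upper[of \<alpha>] \<alpha>_pos by simp
  note energy = first_integral[OF sol differentiable this]
  have abs_velocity: "\<bar>deriv u t\<bar> = speed W (u t)" if "\<bar>u t\<bar> \<le> \<alpha>" for t
  proof -
    have "1 / sqrt (1 + (deriv u t)\<^sup>2) = 1 - W (u t)"
      using energy[of t] by simp
    then have "(1 - W (u t))\<^sup>2 = 1 / (1 + (deriv u t)\<^sup>2)"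
      by (metis add_nonneg_nonneg power_one power_divide real_sqrt_pow2 zero_le_one zero_le_power2)
    then show ?thesis
      by (simp add: speed_def)
  qed
  have inside: "\<bar>u t\<bar> < \<alpha>" for t
    using abs_velocity speed_le by (intro trapped[OF \<alpha>_pos start u', of K]) simp
  then have nonzero: "deriv u t \<noteq> 0" for t
    using abs_velocity[of t] speed_pos[of "u t"] inside[of t] by auto
  have "continuous_on UNIV (deriv u)"
    using u''_ex by (simp add: continuous_on_eq_continuous_at differentiable_imp_continuous_within)
  then have conn: "connected (range (deriv u))"
    by (intro connected_continuous_image) auto
  have positive: "deriv u t > 0" for t
  proof (rule ccontr)
    assume "\<not> deriv u t > 0"
    have neg: "deriv u s \<le> 0" for s
    proof (rule ccontr)
      assume "\<not> deriv u s \<le> 0"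
      then have "0 \<in> range (deriv u)"
        using \<open>\<not> deriv u t > 0\<close>
        by (intro connectedD_interval[OF conn, of "deriv u t" "deriv u s" 0]) auto
      with nonzero show False
        by force
    qed
    have "u s \<le> 0" if "s \<ge> 0" for s
    proof -
      have "u 0 \<ge> u s"
        by (rule DERIV_nonpos_imp_nonincreasing[OF that]) (use u' neg in blast)
      then show ?thesis
        by (simp add: start)
    qed
    then have "\<forall>\<^sub>F s in at_top. u s \<le> 0"
      using eventually_ge_at_top[of 0] by (rule eventually_mono[rotated])
    then have "\<alpha> \<le> 0"
      using tendsto_upperbound[OF u_lim] by simp
    then show False
      using \<alpha>_pos by simp
  qed
  show ?thesis
  proof unfold_locales
    show "(u has_real_derivative speed W (u t)) (at t)" for t
      using u'[of t] abs_velocity[of t] positive[of t] inside[of t] by simp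
  qed (use start inside in auto)
qed

lemma ex_unique_speed_orbit:
  "\<exists>q. speed_orbit W \<alpha> k K M q \<and> (\<forall>u. speed_orbit W \<alpha> k K M u \<longrightarrow> u = q)"
proof -
  have cont: "isCont (speed W) x" if "\<bar>x\<bar> < \<alpha>" for x
    using speed_differentiable[OF that] by (rule differentiable_imp_continuous_within)
  have le: "speed W x \<le> K * (\<alpha>\<^sup>2 - x\<^sup>2)" if "\<bar>x\<bar> < \<alpha>" for x
    using speed_le that by simp
  obtain q where q: "q 0 = 0" "\<And>t. \<bar>q t\<bar> < \<alpha>"
      "\<And>t. (q has_real_derivative speed W (q t)) (at t)"
    and uniq: "\<And>u. \<lbrakk>u 0 = 0; \<And>t. \<bar>u t\<bar> < \<alpha>; \<And>t. (u has_real_derivative speed W (u t)) (at t)\<rbrakk>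
        \<Longrightarrow> u = q"
    by (rule autonomous_heteroclinic[OF \<alpha>_pos K_pos cont speed_pos le]) blast+
  have "speed_orbit W \<alpha> k K M q"
    by unfold_locales (use q in auto)
  moreover have "u = q" if "speed_orbit W \<alpha> k K M u" for u
    by (intro uniq speed_orbit.start[OF that] speed_orbit.inside[OF that]
          speed_orbit.velocity[OF that])
  ultimately show ?thesis
    by blast
qed

lemma heteroclinic_properties:
  "\<exists>q. heteroclinic_solution W \<alpha> q \<and> C1_Holder_loc (1 / 2) q \<and>
      (\<forall>u. heteroclinic_solution W \<alpha> u \<longrightarrow> u = q) \<and>
      (\<exists>\<theta>1>0. \<exists>\<theta>2>0. \<exists>\<theta>3>0. \<exists>\<theta>4>0. \<exists>\<beta>1>0. \<exists>\<beta>2>0. \<exists>\<beta>3>0. \<exists>\<beta>4>0.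
         (\<forall>t\<ge>0. 0 < \<alpha> - q t \<and> \<alpha> - q t \<le> \<theta>1 * exp (- \<theta>2 * t) \<and>
                0 < deriv q t \<and> deriv q t \<le> \<beta>1 * exp (- \<beta>2 * t)) \<and>
         (\<forall>t\<le>0. 0 < \<alpha> + q t \<and> \<alpha> + q t \<le> \<theta>3 * exp (\<theta>4 * t) \<and>
                0 < deriv q t \<and> deriv q t \<le> \<beta>3 * exp (\<beta>4 * t))) \<and>
      ((\<forall>t. W t = (t\<^sup>2 - \<alpha>\<^sup>2)\<^sup>2) \<longrightarrow>
         (\<forall>t\<ge>0. \<alpha> * tanh (\<alpha> * sqrt 2 * t) \<le> q t \<and>
                q t \<le> \<alpha> * tanh (\<alpha> * sqrt 2 * t / (1 / sqrt (1 + (Linf_norm (deriv q))\<^sup>2)))))"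
proof -
  obtain q where q: "speed_orbit W \<alpha> k K M q" and uniq: "\<And>u. speed_orbit W \<alpha> k K M u \<Longrightarrow> u = q"
    using ex_unique_speed_orbit by blast
  interpret speed_orbit W \<alpha> k K M q
    by (rule q)
  have gap: "0 < \<alpha> - q t" "0 < \<alpha> + q t" "0 < deriv q t" for t
    using inside[of t] speed_pos[OF inside[of t]] by (auto simp: deriv_eq abs_less_iff)
  let ?\<theta> = "2 * \<alpha>" and ?\<beta> = "4 * \<alpha>\<^sup>2 * K" and ?r = "2 * \<alpha> * k"
  have const_pos: "0 < ?\<theta>" "0 < ?\<beta>" "0 < ?r"
    using \<alpha>_pos k_pos K_pos by auto
  have decay: "\<exists>\<theta>1>0. \<exists>\<theta>2>0. \<exists>\<theta>3>0. \<exists>\<theta>4>0. \<exists>\<beta>1>0. \<exists>\<beta>2>0. \<exists>\<beta>3>0. \<exists>\<beta>4>0.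
         (\<forall>t\<ge>0. 0 < \<alpha> - q t \<and> \<alpha> - q t \<le> \<theta>1 * exp (- \<theta>2 * t) \<and>
                0 < deriv q t \<and> deriv q t \<le> \<beta>1 * exp (- \<beta>2 * t)) \<and>
         (\<forall>t\<le>0. 0 < \<alpha> + q t \<and> \<alpha> + q t \<le> \<theta>3 * exp (\<theta>4 * t) \<and>
                0 < deriv q t \<and> deriv q t \<le> \<beta>3 * exp (\<beta>4 * t))"
  proof (rule exI[of _ ?\<theta>], rule conjI[OF const_pos(1)],
      rule exI[of _ ?r], rule conjI[OF const_pos(3)],
      rule exI[of _ ?\<theta>], rule conjI[OF const_pos(1)],
      rule exI[of _ ?r], rule conjI[OF const_pos(3)],
      rule exI[of _ ?\<beta>], rule conjI[OF const_pos(2)],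
      rule exI[of _ ?r], rule conjI[OF const_pos(3)],
      rule exI[of _ ?\<beta>], rule conjI[OF const_pos(2)],
      rule exI[of _ ?r], rule conjI[OF const_pos(3)],
      rule conjI)
    show "\<forall>t\<ge>0. 0 < \<alpha> - q t \<and> \<alpha> - q t \<le> ?\<theta> * exp (- ?r * t) \<and>
        0 < deriv q t \<and> deriv q t \<le> ?\<beta> * exp (- ?r * t)"
      using gap gap_decay velocity_decay unfolding deriv_eq by blast
    show "\<forall>t\<le>0. 0 < \<alpha> + q t \<and> \<alpha> + q t \<le> ?\<theta> * exp (?r * t) \<and>
        0 < deriv q t \<and> deriv q t \<le> ?\<beta> * exp (?r * t)"
      using gap gap_decay_left velocity_decay_left unfolding deriv_eq by blast
  qed
  show ?thesis
  proof (rule exI[of _ q], intro conjI)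
    show "\<forall>u. heteroclinic_solution W \<alpha> u \<longrightarrow> u = q"
      using uniq heteroclinic_imp_speed_orbit by blast
    show "(\<forall>t. W t = (t\<^sup>2 - \<alpha>\<^sup>2)\<^sup>2) \<longrightarrow>
        (\<forall>t\<ge>0. \<alpha> * tanh (\<alpha> * sqrt 2 * t) \<le> q t \<and>
          q t \<le> \<alpha> * tanh (\<alpha> * sqrt 2 * t / (1 / sqrt (1 + (Linf_norm (deriv q))\<^sup>2))))"
    proof (intro impI allI conjI)
      fix t :: real assume "\<forall>t. W t = (t\<^sup>2 - \<alpha>\<^sup>2)\<^sup>2" and t: "0 \<le> t"
      then have W: "W x = (x\<^sup>2 - \<alpha>\<^sup>2)\<^sup>2" for x
        by blast
      show "\<alpha> * tanh (\<alpha> * sqrt 2 * t) \<le> q t"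
        by (rule quartic_tanh_bounds(1)[OF W t])
      show "q t \<le> \<alpha> * tanh (\<alpha> * sqrt 2 * t / (1 / sqrt (1 + (Linf_norm (deriv q))\<^sup>2)))"
        by (rule quartic_tanh_bounds(2)[OF W t])
    qed
  qed (rule heteroclinic C1_Holder decay)+
qed

end

text \<open>The growth conditions on \<open>W'\<close> give \<open>k\<close> and \<open>K\<close> through the comparison with the quartic.
  The potential vanishes at \<open>\<alpha>\<close> and no point of the well is further than \<open>2 \<alpha>\<close> from there, so
  \<open>W \<le> 2 \<alpha> M \<le> 1 / 2\<close>.\<close>
lemma shallow_double_wellI:
  fixes W :: "real \<Rightarrow> real"
  assumes "\<alpha> > 0" and W: "\<And>x. W differentiable (at x)" and zeros: "W \<alpha> = 0" "W (- \<alpha>) = 0"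
    and bound: "\<And>x. \<bar>x\<bar> \<le> \<alpha> \<Longrightarrow> \<bar>deriv W x\<bar> \<le> M" and small: "4 * \<alpha> * M \<le> 1"
    and pos: "d1 > 0" "d2 > 0" "d3 > 0" "d4 > 0"
    and right: "\<And>t. t \<in> {0..\<alpha>} \<Longrightarrow>
        - d1 * t * \<bar>t - \<alpha>\<bar> \<le> deriv W t \<and> deriv W t \<le> - d2 * t * \<bar>t - \<alpha>\<bar>"
    and left: "\<And>t. t \<in> {- \<alpha>..0} \<Longrightarrow>
        - d3 * t * \<bar>t + \<alpha>\<bar> \<le> deriv W t \<and> deriv W t \<le> - d4 * t * \<bar>t + \<alpha>\<bar>"
  shows "\<exists>k K. shallow_double_well W \<alpha> k K M"
proof -
  \<comment> \<open>The slope of \<open>W\<close> is at most 0 on \<open>[0, \<alpha>]\<close> and at least 0 on \<open>[-\<alpha>, 0]\<close>, so its modulus,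
    relative to \<open>\<bar>t\<bar> (\<alpha> - \<bar>t\<bar>)\<close>, is bounded above by \<open>d1\<close> or \<open>d4\<close> and below by \<open>d2\<close> or \<open>d3\<close>.\<close>
  define a where "a = max d1 d4"
  define b where "b = min d2 d3"
  have a: "a > 0" "d1 \<le> a" "d4 \<le> a" and b: "b > 0" "b \<le> d2" "b \<le> d3"
    using pos by (auto simp: a_def b_def)
  have right': "- a * x * (\<alpha> - x) \<le> deriv W x \<and> deriv W x \<le> - b * x * (\<alpha> - x)"
    if "0 \<le> x" "x \<le> \<alpha>" for x
  proof -
    have "d1 * (x * (\<alpha> - x)) \<le> a * (x * (\<alpha> - x))" "b * (x * (\<alpha> - x)) \<le> d2 * (x * (\<alpha> - x))"
      using that a b by (auto intro!: mult_right_mono)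
    with right[of x] that show ?thesis
      by (auto simp: mult.assoc)
  qed
  have left': "b * x * (\<alpha> - x) \<le> deriv W (- x) \<and> deriv W (- x) \<le> a * x * (\<alpha> - x)"
    if "0 \<le> x" "x \<le> \<alpha>" for x
  proof -
    have "d4 * (x * (\<alpha> - x)) \<le> a * (x * (\<alpha> - x))" "b * (x * (\<alpha> - x)) \<le> d3 * (x * (\<alpha> - x))"
      using that a b by (auto intro!: mult_right_mono)
    with left[of "- x"] that show ?thesis
      by (auto simp: mult.assoc)
  qed
  have quartic: "W x \<le> a / (4 * \<alpha>) * (\<alpha>\<^sup>2 - x\<^sup>2)\<^sup>2" "b / (8 * \<alpha>) * (\<alpha>\<^sup>2 - x\<^sup>2)\<^sup>2 \<le> W x"
    if "\<bar>x\<bar> \<le> \<alpha>" for x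
    using quartic_bounds[OF \<open>\<alpha> > 0\<close> W zeros right' left' _ _ that] a b by auto
  have "shallow_double_well W \<alpha> (sqrt (b / (4 * \<alpha>))) (sqrt (2 * a / \<alpha>)) M"
  proof
    fix x assume x: "\<bar>x\<bar> \<le> \<alpha>"
    show "(sqrt (b / (4 * \<alpha>)))\<^sup>2 * (\<alpha>\<^sup>2 - x\<^sup>2)\<^sup>2 \<le> 2 * W x"
      using quartic(2)[OF x] \<open>\<alpha> > 0\<close> b by (simp add: field_simps)
    show "8 * W x \<le> (sqrt (2 * a / \<alpha>))\<^sup>2 * (\<alpha>\<^sup>2 - x\<^sup>2)\<^sup>2"
      using quartic(1)[OF x] \<open>\<alpha> > 0\<close> a by (simp add: field_simps)
    have M: "M \<ge> 0"
      using bound[OF x] by linarith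
    have "norm (W x - W \<alpha>) \<le> M * norm (x - \<alpha>)"
    proof (rule field_differentiable_bound[of "{- \<alpha>..\<alpha>}" W "deriv W"])
      fix z assume "z \<in> {- \<alpha>..\<alpha>}"
      then show "norm (deriv W z) \<le> M"
        using bound[of z] by auto
      show "(W has_field_derivative deriv W z) (at z within {- \<alpha>..\<alpha>})"
        using W by (simp add: has_field_derivative_at_within DERIV_deriv_iff_real_differentiable)
    qed (use x \<open>\<alpha> > 0\<close> in auto)
    also have "\<dots> \<le> M * (2 * \<alpha>)"
      using x M by (intro mult_left_mono) auto
    also have "\<dots> \<le> 1 / 2"
      using small by (simp add: algebra_simps)
    finally show "W x \<le> 1 / 2"
      using zeros(1) by simp
  qed (use \<open>\<alpha> > 0\<close> a b W bound in auto)
  then show ?thesis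
    by blast
qed

theorem theorem1p3:
  fixes V :: "real \<Rightarrow> real \<Rightarrow> real"
  assumes C2: "\<And>\<alpha>. \<alpha> > 0 \<Longrightarrow> C2 (V \<alpha>)"
    and V1: "\<And>\<alpha> t. \<alpha> > 0 \<Longrightarrow> V \<alpha> t \<ge> 0"
    and V2: "\<And>\<alpha>. \<alpha> > 0 \<Longrightarrow>
               V \<alpha> \<alpha> = 0 \<and> V \<alpha> (- \<alpha>) = 0 \<and> (\<forall>t\<in>{- \<alpha><..<\<alpha>}. V \<alpha> t > 0)"
    and V6: "\<And>\<alpha>. \<alpha> > 0 \<Longrightarrow>
               deriv (deriv (V \<alpha>)) (- \<alpha>) > 0 \<and> deriv (deriv (V \<alpha>)) \<alpha> > 0"
    and V7: "\<And>\<alpha>. \<alpha> > 0 \<Longrightarrow>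
               \<exists>d1>0. \<exists>d2>0. \<exists>d3>0. \<exists>d4>0.
                 (\<forall>t\<in>{0..\<alpha>}. - d1 * t * \<bar>t - \<alpha>\<bar> \<le> deriv (V \<alpha>) t \<and>
                            deriv (V \<alpha>) t \<le> - d2 * t * \<bar>t - \<alpha>\<bar>) \<and>
                 (\<forall>t\<in>{- \<alpha>..0}. - d3 * t * \<bar>t + \<alpha>\<bar> \<le> deriv (V \<alpha>) t \<and>
                              deriv (V \<alpha>) t \<le> - d4 * t * \<bar>t + \<alpha>\<bar>)"
    and V8: "\<exists>\<alpha>'>0. \<exists>M>0. \<forall>\<alpha>\<in>{0<..<\<alpha>'}.
               (SUP t\<in>{t. \<bar>t\<bar> \<in> {0..\<alpha>}}. \<bar>deriv (V \<alpha>) t\<bar>) \<le> M"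
  shows "\<exists>\<alpha>0>0. \<exists>\<kappa>::real \<Rightarrow> real. (\<forall>s\<ge>0. \<kappa> s > 0) \<and>
           (\<forall>\<alpha>\<in>{0<..<\<alpha>0}. \<exists>\<gamma>\<in>{0<..<1}. \<exists>q.
              heteroclinic_solution (V \<alpha>) \<alpha> q \<and> C1_Holder_loc \<gamma> q \<and>
              (\<forall>u. heteroclinic_solution (V \<alpha>) \<alpha> u \<longrightarrow> u = q) \<and>
              (\<exists>\<theta>1>0. \<exists>\<theta>2>0. \<exists>\<theta>3>0. \<exists>\<theta>4>0. \<exists>\<beta>1>0. \<exists>\<beta>2>0. \<exists>\<beta>3>0. \<exists>\<beta>4>0.
                 (\<forall>t\<ge>0. 0 < \<alpha> - q t \<and> \<alpha> - q t \<le> \<theta>1 * exp (- \<theta>2 * t) \<and>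
                        0 < deriv q t \<and> deriv q t \<le> \<beta>1 * exp (- \<beta>2 * t)) \<and>
                 (\<forall>t\<le>0. 0 < \<alpha> + q t \<and> \<alpha> + q t \<le> \<theta>3 * exp (\<theta>4 * t) \<and>
                        0 < deriv q t \<and> deriv q t \<le> \<beta>3 * exp (\<beta>4 * t))) \<and>
              ((\<forall>t. V \<alpha> t = (t\<^sup>2 - \<alpha>\<^sup>2)\<^sup>2) \<longrightarrow>
                 (\<forall>t\<ge>0. \<alpha> * tanh (\<alpha> * sqrt 2 * t) \<le> q t \<and>
                        q t \<le> \<alpha> * tanh (\<alpha> * sqrt 2 * t / \<kappa> (Linf_norm (deriv q))))))"
proof -
  obtain \<alpha>' M where "\<alpha>' > 0" "M > 0"
    and sup: "\<And>\<alpha>. \<alpha> \<in> {0<..<\<alpha>'} \<Longrightarrow> (SUP t\<in>{t. \<bar>t\<bar> \<in> {0..\<alpha>}}. \<bar>deriv (V \<alpha>) t\<bar>) \<le> M"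
    using V8 by blast
  define \<alpha>0 where "\<alpha>0 = min \<alpha>' (1 / (4 * M))"
  define \<kappa> where "\<kappa> s = 1 / sqrt (1 + s\<^sup>2)" for s :: real
  have well: "\<exists>k K. shallow_double_well (V \<alpha>) \<alpha> k K M" if \<alpha>: "\<alpha> \<in> {0<..<\<alpha>0}" for \<alpha>
  proof -
    have "\<alpha> > 0" "\<alpha> < \<alpha>'" "\<alpha> < 1 / (4 * M)"
      using \<alpha> by (auto simp: \<alpha>0_def)
    have small: "4 * \<alpha> * M \<le> 1"
      using \<open>\<alpha> < 1 / (4 * M)\<close> \<open>M > 0\<close> by (simp add: field_simps)
    have diff: "V \<alpha> differentiable (at x)" "deriv (V \<alpha>) differentiable (at x)" for x
      using C2[OF \<open>\<alpha> > 0\<close>] by (auto simp: C2_def twice_differentiable_def)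
    have Icc: "{t. \<bar>t\<bar> \<in> {0..\<alpha>}} = {- \<alpha>..\<alpha>}"
      by auto
    have "continuous_on {- \<alpha>..\<alpha>} (deriv (V \<alpha>))"
      using diff(2) by (intro continuous_at_imp_continuous_on ballI
          differentiable_imp_continuous_within)
    then have "compact ((\<lambda>t. \<bar>deriv (V \<alpha>) t\<bar>) ` {- \<alpha>..\<alpha>})"
      by (intro compact_continuous_image continuous_intros) auto
    then have bdd: "bdd_above ((\<lambda>t. \<bar>deriv (V \<alpha>) t\<bar>) ` {- \<alpha>..\<alpha>})"
      by (intro bounded_imp_bdd_above compact_imp_bounded)
    have bound: "\<bar>deriv (V \<alpha>) x\<bar> \<le> M" if "\<bar>x\<bar> \<le> \<alpha>" for x
    proof -
      have "\<bar>deriv (V \<alpha>) x\<bar> \<le> (SUP t\<in>{- \<alpha>..\<alpha>}. \<bar>deriv (V \<alpha>) t\<bar>)"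
        using that by (intro cSUP_upper[OF _ bdd]) auto
      also have "\<dots> \<le> M"
        using sup[of \<alpha>] \<open>\<alpha> > 0\<close> \<open>\<alpha> < \<alpha>'\<close> unfolding Icc by auto
      finally show ?thesis .
    qed
    obtain d1 d2 d3 d4 where pos: "d1 > 0" "d2 > 0" "d3 > 0" "d4 > 0"
      and "\<forall>t\<in>{0..\<alpha>}. - d1 * t * \<bar>t - \<alpha>\<bar> \<le> deriv (V \<alpha>) t \<and>
                        deriv (V \<alpha>) t \<le> - d2 * t * \<bar>t - \<alpha>\<bar>"
      and "\<forall>t\<in>{- \<alpha>..0}. - d3 * t * \<bar>t + \<alpha>\<bar> \<le> deriv (V \<alpha>) t \<and>
                          deriv (V \<alpha>) t \<le> - d4 * t * \<bar>t + \<alpha>\<bar>"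
      using V7[OF \<open>\<alpha> > 0\<close>] by blast
    then show ?thesis
      using V2[OF \<open>\<alpha> > 0\<close>]
      by (intro shallow_double_wellI[OF \<open>\<alpha> > 0\<close> diff(1) _ _ bound small pos]) auto
  qed
  have \<alpha>0_pos: "\<alpha>0 > 0"
    using \<open>\<alpha>' > 0\<close> \<open>M > 0\<close> by (simp add: \<alpha>0_def)
  have \<kappa>_pos: "\<forall>s\<ge>0. \<kappa> s > 0"
    by (simp add: \<kappa>_def add_pos_nonneg)
  show ?thesis
    by (rule exI[of _ \<alpha>0], rule conjI[OF \<alpha>0_pos], rule exI[of _ \<kappa>], rule conjI[OF \<kappa>_pos],
        rule ballI, rule bexI[of _ "1 / 2"], drule well, unfold \<kappa>_def, elim exE,
        erule shallow_double_well.heteroclinic_properties) simp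
qed

end
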